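(* Let $n\ge 1$. The only complete minimal hypersurfaces of revolution about the $t$-axis in $\mathbb{H}^n$ are Euclidean hyperplanes orthogonal to the $t$-axis and catenoidal type hypersurfaces; that is, every such hypersurface is of one of these two kinds.
   Context: $\mathbb{H}^n$ is $\mathbb{R}^{2n+1}\equiv\mathbb{C}^n\times\mathbb{R}$, with coordinates $[z,t]$, $z_k=x_k+iy_k$, and product $[z,t]*[z',t']=[z+z',t+t'+\mathrm{Im}(\sum_{i}z_i\overline{z}'_i)]$. Set $X_k=\partial_{x_k}+y_k\partial_t$, $Y_k=\partial_{y_k}-x_k\partial_t$ ($k=1,\dots,n$), $T=\partial_t$. The horizontal distribution is spanned by $\{X_k,Y_k\}$; $U_H$ denotes the projection of $U$ onto it. $g=\langle\cdot,\cdot\rangle$ is the Riemannian metric making $\{X_k,Y_k,T\}$ orthonormal. For a $C^2$ hypersurface $\Sigma$ with unit normal $N$ in $(\mathbb{H}^n,g)$, the singular set is $\Sigma_0=\{N_H=0\}$; on $\Sigma-\Sigma_0$ put $\nu_H=N_H/|N_H|$ and define the mean curvature $H$ by $-2nH=\mathrm{div}_\Sigma\,\nu_H$, where $\mathrm{div}_\Sigma$ is the Riemannian divergence relative to $\Sigma$ in $(\mathbb{H}^n,g)$. $\Sigma$ is minimal if $H=0$ on $\Sigma-\Sigma_0$. A hypersurface of revolution about the $t$-axis is the image of $(s,\omega)\mapsto(x(s)\omega,t(s))$, $\omega\in\mathbb{S}^{2n-1}$, where $\gamma(s)=(x(s),t(s))$, $s\in I$ ($I$ an interval), is an arc-length parametrized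 curve in the half-plane $\{(x,t):x\ge0\}$; write $x'=\sin\sigma$, $t'=\cos\sigma$. If the hypersurface is minimal then, where $x>0$, $(x,t,\sigma)$ satisfies $$x'=\sin\sigma,\qquad t'=\cos\sigma,\qquad \sigma'=(2n-1)\frac{\cos^3\sigma}{x^3}+2(n-1)\frac{\sin^2\sigma\cos\sigma}{x}.$$ The minimal hypersurface of revolution is called complete if its generating curve in $\{x>0\}$ is a maximal (non-extendable) solution of this system, the limit points of $\gamma$ on the $t$-axis, if any, being adjoined. A hypersurface of revolution is of catenoidal type if, up to a translation along the $t$-axis, its generating curve is the graph of an even, strictly convex $C^2$ function $x:(-a,a)\to(0,+\infty)$, $0<a\le+\infty$, with $x(t)\to+\infty$ as $t\to\pm a$. *)

theory Defs
  imports "HOL-Analysis.Analysis"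
begin

section \<open>The Riemannian Heisenberg group\<close>

text \<open>
  The underlying manifold of the Heisenberg group is the Euclidean space of pairs \<open>(z, t)\<close> with
  \<open>z\<close> in complex n-space, \<open>n = CARD('n)\<close>. A tangent vector at any point is again a pair \<open>(w, \<tau>)\<close>,
  written in the coordinate basis: \<open>w $ k = a + \<i> b\<close> stands for \<open>a \<partial>\<^bsub>x\<^sub>k\<^esub> + b \<partial>\<^bsub>y\<^sub>k\<^esub>\<close>, and \<open>\<tau>\<close> for \<open>\<tau> \<partial>\<^sub>t\<close>.
\<close>

type_synonym 'n heis = "(complex ^ 'n) \<times> real"

definition X_field :: "'n::finite \<Rightarrow> 'n heis \<Rightarrow> 'n heis" where
  "X_field k p = (axis k 1, Im (fst p $ k))"

definition Y_field :: "'n::finite \<Rightarrow> 'n heis \<Rightarrow> 'n heis" where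
  "Y_field k p = (axis k \<i>, - Re (fst p $ k))"

definition T_field :: "'n::finite heis \<Rightarrow> 'n heis" where
  "T_field p = (0, 1)"

text \<open>The coefficient of \<open>U\<close> on \<open>T\<close> in the frame \<open>X\<^sub>k, Y\<^sub>k, T\<close>; those on \<open>X\<^sub>k\<close> and \<open>Y\<^sub>k\<close> are
  \<open>Re (fst U $ k)\<close> and \<open>Im (fst U $ k)\<close>, see \<open>frame_expansion\<close>.\<close>

definition T_coeff :: "'n::finite heis \<Rightarrow> 'n heis \<Rightarrow> real" where
  "T_coeff p U = snd U - (\<Sum>k\<in>UNIV. Im (fst p $ k) * Re (fst U $ k) - Re (fst p $ k) * Im (fst U $ k))"

text \<open>The metric at \<open>p\<close> for which the frame is orthonormal.\<close>

definition heis_metric :: "'n::finite heis \<Rightarrow> 'n heis \<Rightarrow> 'n heis \<Rightarrow> real" where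
  "heis_metric p U V =
     (\<Sum>k\<in>UNIV. Re (fst U $ k) * Re (fst V $ k) + Im (fst U $ k) * Im (fst V $ k))
     + T_coeff p U * T_coeff p V"

lemma frame_expansion:
  "U = (\<Sum>k\<in>UNIV. Re (fst U $ k) *\<^sub>R X_field k p + Im (fst U $ k) *\<^sub>R Y_field k p)
        + T_coeff p U *\<^sub>R T_field p"
proof (rule prod_eqI)
  have "fst U $ j = (\<Sum>k\<in>UNIV. Re (fst U $ k) *\<^sub>R axis k 1 + Im (fst U $ k) *\<^sub>R axis k \<i>) $ j" for j
  proof -
    have "(\<Sum>k\<in>UNIV. Re (fst U $ k) *\<^sub>R axis k 1 + Im (fst U $ k) *\<^sub>R axis k \<i>) $ j
       = (\<Sum>k\<in>UNIV. if k = j then Re (fst U $ j) *\<^sub>R 1 + Im (fst U $ j) *\<^sub>R \<i> else (0::complex))"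
      unfolding sum_component by (rule sum.cong) (auto simp: axis_def)
    then show ?thesis
      by (simp add: complex_eq_iff)
  qed
  then have "(\<Sum>k\<in>UNIV. Re (fst U $ k) *\<^sub>R axis k 1 + Im (fst U $ k) *\<^sub>R axis k \<i>) = fst U"
    unfolding vec_eq_iff by metis
  then show "fst U = fst ((\<Sum>k\<in>UNIV. Re (fst U $ k) *\<^sub>R X_field k p + Im (fst U $ k) *\<^sub>R Y_field k p)
        + T_coeff p U *\<^sub>R T_field p)"
    by (simp add: fst_sum X_field_def Y_field_def T_field_def)
next
  show "snd U = snd ((\<Sum>k\<in>UNIV. Re (fst U $ k) *\<^sub>R X_field k p + Im (fst U $ k) *\<^sub>R Y_field k p)
        + T_coeff p U *\<^sub>R T_field p)"
    by (simp add: snd_sum X_field_def Y_field_def T_field_def T_coeff_def sum_subtractf[symmetric]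
        mult.commute)
qed

lemma T_coeff_frame [simp]:
  "T_coeff p (X_field k p) = 0" "T_coeff p (Y_field k p) = 0" "T_coeff p (T_field p) = 1"
proof -
  have "(\<Sum>j\<in>UNIV. Im (fst p $ j) * Re (axis k 1 $ j) - Re (fst p $ j) * Im (axis k 1 $ j))
      = (\<Sum>j\<in>UNIV. if j = k then Im (fst p $ k) else 0)"
    by (rule sum.cong) (auto simp: axis_def)
  moreover have "(\<Sum>j\<in>UNIV. Im (fst p $ j) * Re (axis k \<i> $ j) - Re (fst p $ j) * Im (axis k \<i> $ j))
      = (\<Sum>j\<in>UNIV. if j = k then - Re (fst p $ k) else 0)"
    by (rule sum.cong) (auto simp: axis_def)
  ultimately show "T_coeff p (X_field k p) = 0" "T_coeff p (Y_field k p) = 0" "T_coeff p (T_field p) = 1"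
    by (simp_all add: T_coeff_def X_field_def Y_field_def T_field_def)
qed

lemma heis_metric_frame:
  "heis_metric p (X_field j p) (X_field k p) = (if j = k then 1 else 0)"
  "heis_metric p (Y_field j p) (Y_field k p) = (if j = k then 1 else 0)"
  "heis_metric p (X_field j p) (Y_field k p) = 0"
  "heis_metric p (X_field j p) (T_field p) = 0"
  "heis_metric p (Y_field j p) (T_field p) = 0"
  "heis_metric p (T_field p) (T_field p) = 1"
proof -
  have "heis_metric p (X_field j p) (X_field k p) =
      (\<Sum>i\<in>UNIV. Re (axis j 1 $ i) * Re (axis k 1 $ i) + Im (axis j 1 $ i) * Im (axis k 1 $ i))"
    by (simp add: heis_metric_def) (simp add: X_field_def)
  also have "\<dots> = (\<Sum>i\<in>UNIV. if i = j then (if j = k then 1 else 0) else (0::real))"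
    by (rule sum.cong) (auto simp: axis_def)
  finally show "heis_metric p (X_field j p) (X_field k p) = (if j = k then 1 else 0)"
    by simp
  have "heis_metric p (Y_field j p) (Y_field k p) =
      (\<Sum>i\<in>UNIV. Re (axis j \<i> $ i) * Re (axis k \<i> $ i) + Im (axis j \<i> $ i) * Im (axis k \<i> $ i))"
    by (simp add: heis_metric_def) (simp add: Y_field_def)
  also have "\<dots> = (\<Sum>i\<in>UNIV. if i = j then (if j = k then 1 else 0) else (0::real))"
    by (rule sum.cong) (auto simp: axis_def)
  finally show "heis_metric p (Y_field j p) (Y_field k p) = (if j = k then 1 else 0)"
    by simp
  show "heis_metric p (X_field j p) (Y_field k p) = 0"
    by (simp add: heis_metric_def) (auto simp: X_field_def Y_field_def axis_def intro!: sum.neutral)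
  show "heis_metric p (X_field j p) (T_field p) = 0" "heis_metric p (Y_field j p) (T_field p) = 0"
    "heis_metric p (T_field p) (T_field p) = 1"
    by (simp_all add: heis_metric_def) (simp_all add: T_field_def)
qed

definition horizontal_part :: "'n::finite heis \<Rightarrow> 'n heis \<Rightarrow> 'n heis" where
  "horizontal_part p U =
     (\<Sum>k\<in>UNIV. heis_metric p U (X_field k p) *\<^sub>R X_field k p
              + heis_metric p U (Y_field k p) *\<^sub>R Y_field k p)"

definition heis_norm :: "'n::finite heis \<Rightarrow> 'n heis \<Rightarrow> real" where
  "heis_norm p U = sqrt (heis_metric p U U)"

text \<open>
  The Levi-Civita connection in the global coordinates is \<open>\<nabla>\<^sub>U V = dV(U) + christoffel p U V\<close>.
  The Koszul formula for constant coordinate fields determines the Christoffel term.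
\<close>

definition christoffel :: "'n::finite heis \<Rightarrow> 'n heis \<Rightarrow> 'n heis \<Rightarrow> 'n heis" where
  "christoffel p U V =
     (THE C. \<forall>W. 2 * heis_metric p C W =
        frechet_derivative (\<lambda>q. heis_metric q V W) (at p) U
      + frechet_derivative (\<lambda>q. heis_metric q U W) (at p) V
      - frechet_derivative (\<lambda>q. heis_metric q U V) (at p) W)"

text \<open>The description is satisfied by exactly one vector, computed in \<open>christoffel_eq\<close>.\<close>

lemma has_derivative_heis_metric:
  fixes p V W :: "'n::finite heis"
  shows
  "((\<lambda>q. heis_metric q V W) has_derivative
     (\<lambda>U. (T_coeff U V - snd V) * T_coeff p W + T_coeff p V * (T_coeff U W - snd W))) (at p)"
proof -
  have nth: "((\<lambda>q. fst q $ k) has_derivative (\<lambda>U. fst U $ k)) (at p)" for k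
    by (intro bounded_linear_imp_has_derivative
        bounded_linear_compose[OF bounded_linear_vec_nth bounded_linear_fst])
  have *: "((\<lambda>q. T_coeff q V) has_derivative (\<lambda>U. T_coeff U V - snd V)) (at p)" for V
    unfolding T_coeff_def by (auto intro!: derivative_eq_intros nth)
  show ?thesis
    unfolding heis_metric_def by (rule derivative_eq_intros * refl)+ (simp add: algebra_simps)
qed

lemma christoffel_eq:
  fixes p U V :: "'n::finite heis"
  defines "c \<equiv> \<chi> k. \<i> * (T_coeff p V *\<^sub>R (fst U $ k) + T_coeff p U *\<^sub>R (fst V $ k))"
  shows "christoffel p U V = (c, \<Sum>k\<in>UNIV. Im (fst p $ k) * Re (c $ k) - Re (fst p $ k) * Im (c $ k))"
    (is "_ = ?C")
proof -
  let ?R = "\<lambda>W. frechet_derivative (\<lambda>q. heis_metric q V W) (at p) U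
      + frechet_derivative (\<lambda>q. heis_metric q U W) (at p) V
      - frechet_derivative (\<lambda>q. heis_metric q U V) (at p) W"
  have fd: "frechet_derivative (\<lambda>q. heis_metric q A B) (at p) =
     (\<lambda>U. (T_coeff U A - snd A) * T_coeff p B + T_coeff p A * (T_coeff U B - snd B))" for A B
    by (rule frechet_derivative_at[OF has_derivative_heis_metric, symmetric])
  have omega: "T_coeff A B - snd B =
      (\<Sum>k\<in>UNIV. Re (fst A $ k) * Im (fst B $ k) - Im (fst A $ k) * Re (fst B $ k))" for A B :: "'n heis"
    by (simp add: T_coeff_def sum_subtractf)
  have anti: "T_coeff A B - snd B = - (T_coeff B A - snd A)" for A B :: "'n heis"
    unfolding omega sum_negf[symmetric] by (rule sum.cong) simp_all
  have T0: "T_coeff p ?C = 0"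
    by (simp add: T_coeff_def)
  have C: "2 * heis_metric p ?C W = ?R W" for W
  proof -
    have "heis_metric p ?C W =
       (\<Sum>k\<in>UNIV. Re (c $ k) * Re (fst W $ k) + Im (c $ k) * Im (fst W $ k))"
      by (simp only: heis_metric_def T0 fst_conv mult_zero_left add_0_right)
    also have "\<dots> = T_coeff p V * (T_coeff U W - snd W) + T_coeff p U * (T_coeff V W - snd W)"
      unfolding omega sum_distrib_left sum.distrib[symmetric]
      by (rule sum.cong) (simp_all add: c_def algebra_simps)
    finally show ?thesis
      unfolding fd anti[of V U] anti[of W U] anti[of W V] by (simp add: algebra_simps)
  qed
  have uniq: "D = ?C" if D: "\<forall>W. 2 * heis_metric p D W = ?R W" for D
  proof -
    have eq: "heis_metric p D W = heis_metric p ?C W" for W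
      using D[rule_format, of W] C[of W] by linarith
    have T_diff: "T_coeff p (A - B) = T_coeff p A - T_coeff p B" for A B
      by (simp add: T_coeff_def sum_subtractf right_diff_distrib)
    have add: "heis_metric p (A - B) W = heis_metric p A W - heis_metric p B W" for A B W
      by (simp add: heis_metric_def T_diff sum_subtractf sum.distrib left_diff_distrib)
    define E where "E = D - ?C"
    have "heis_metric p E E = 0"
      by (subst E_def, subst add) (simp only: eq diff_self)
    then have z: "(\<Sum>k\<in>UNIV. (Re (fst E $ k))\<^sup>2 + (Im (fst E $ k))\<^sup>2) + (T_coeff p E)\<^sup>2 = 0"
      by (simp only: heis_metric_def power2_eq_square)
    have nn: "0 \<le> (\<Sum>k\<in>UNIV. (Re (fst E $ k))\<^sup>2 + (Im (fst E $ k))\<^sup>2)"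
      by (intro sum_nonneg) simp
    have t: "T_coeff p E = 0"
      using z nn by (simp add: add_nonneg_eq_0_iff)
    have "(\<Sum>k\<in>UNIV. (Re (fst E $ k))\<^sup>2 + (Im (fst E $ k))\<^sup>2) = 0"
      using z t by simp
    then have "fst E $ k = 0" for k
      by (subst (asm) sum_nonneg_eq_0_iff) (auto simp: complex_eq_iff sum_power2_eq_zero_iff)
    then have "E = 0"
      using frame_expansion[of E p] t by simp
    then show ?thesis by (simp only: E_def right_minus_eq)
  qed
  show ?thesis
    unfolding christoffel_def by (rule the_equality, intro allI, rule C, rule uniq)
qed


section \<open>Mean curvature of immersed hypersurfaces\<close>

text \<open>
  A hypersurface is given by an immersion \<open>F\<close> of a \<open>2n\<close>-dimensional submanifold \<open>M\<close> of a Euclidean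
  space. The Frechet derivative within \<open>M\<close> is determined only on vectors tangent to \<open>M\<close>, and it is
  applied to no others.
\<close>

definition tangent_space :: "'m::euclidean_space set \<Rightarrow> 'm \<Rightarrow> 'm set" where
  "tangent_space M q =
     {v. \<exists>c \<epsilon>. 0 < \<epsilon> \<and> (\<forall>\<tau>. \<bar>\<tau>\<bar> < \<epsilon> \<longrightarrow> c \<tau> \<in> M) \<and> c 0 = q \<and> (c has_vector_derivative v) (at (0::real))}"

definition push :: "('m::euclidean_space \<Rightarrow> 'n::finite heis) \<Rightarrow> 'm set \<Rightarrow> 'm \<Rightarrow> 'm \<Rightarrow> 'n heis" where
  "push F M q = frechet_derivative F (at q within M)"

text \<open>Covariant derivative, in the direction \<open>push F M q a\<close>, of a vector field \<open>V\<close> along \<open>F\<close>.\<close>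

definition cov_deriv ::
  "('m::euclidean_space \<Rightarrow> 'n::finite heis) \<Rightarrow> 'm set \<Rightarrow> ('m \<Rightarrow> 'n heis) \<Rightarrow> 'm \<Rightarrow> 'm \<Rightarrow> 'n heis" where
  "cov_deriv F M V q a =
     frechet_derivative V (at q within M) a + christoffel (F q) (push F M q a) (V q)"

definition orthonormal_tangent_frame ::
  "('m::euclidean_space \<Rightarrow> 'n::finite heis) \<Rightarrow> 'm set \<Rightarrow> 'm \<Rightarrow> 'm set \<Rightarrow> bool" where
  "orthonormal_tangent_frame F M q A \<longleftrightarrow>
     A \<subseteq> tangent_space M q \<and> finite A \<and> card A = 2 * CARD('n) \<and>
     (\<forall>a\<in>A. \<forall>b\<in>A. heis_metric (F q) (push F M q a) (push F M q b) = (if a = b then 1 else 0))"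

text \<open>The divergence relative to the hypersurface; it does not depend on the frame chosen.\<close>

definition surface_div ::
  "('m::euclidean_space \<Rightarrow> 'n::finite heis) \<Rightarrow> 'm set \<Rightarrow> ('m \<Rightarrow> 'n heis) \<Rightarrow> 'm \<Rightarrow> real" where
  "surface_div F M V q =
     (\<Sum>a\<in>(SOME A. orthonormal_tangent_frame F M q A).
        heis_metric (F q) (cov_deriv F M V q a) (push F M q a))"

definition unit_normal ::
  "('m::euclidean_space \<Rightarrow> 'n::finite heis) \<Rightarrow> 'm set \<Rightarrow> ('m \<Rightarrow> 'n heis) \<Rightarrow> bool" where
  "unit_normal F M N \<longleftrightarrow>
     continuous_on M N \<and>
     (\<forall>q\<in>M. heis_norm (F q) (N q) = 1 \<and>
        (\<forall>a\<in>tangent_space M q. heis_metric (F q) (push F M q a) (N q) = 0))"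

definition singular_set ::
  "('m::euclidean_space \<Rightarrow> 'n::finite heis) \<Rightarrow> 'm set \<Rightarrow> ('m \<Rightarrow> 'n heis) \<Rightarrow> 'm set" where
  "singular_set F M N = {q \<in> M. horizontal_part (F q) (N q) = 0}"

definition horizontal_normal ::
  "('m::euclidean_space \<Rightarrow> 'n::finite heis) \<Rightarrow> ('m \<Rightarrow> 'n heis) \<Rightarrow> 'm \<Rightarrow> 'n heis" where
  "horizontal_normal F N q =
     horizontal_part (F q) (N q) /\<^sub>R heis_norm (F q) (horizontal_part (F q) (N q))"

definition mean_curvature ::
  "('m::euclidean_space \<Rightarrow> 'n::finite heis) \<Rightarrow> 'm set \<Rightarrow> ('m \<Rightarrow> 'n heis) \<Rightarrow> 'm \<Rightarrow> real" where
  "mean_curvature F M N q = - surface_div F M (horizontal_normal F N) q / (2 * real CARD('n))"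

text \<open>Replacing \<open>N\<close> by \<open>- N\<close> only changes the sign of the mean curvature.\<close>

definition minimal_hypersurface ::
  "('m::euclidean_space \<Rightarrow> 'n::finite heis) \<Rightarrow> 'm set \<Rightarrow> bool" where
  "minimal_hypersurface F M \<longleftrightarrow>
     (\<exists>N. unit_normal F M N \<and> (\<forall>q\<in>M - singular_set F M N. mean_curvature F M N q = 0))"


section \<open>Hypersurfaces of revolution\<close>

definition revolve :: "(real \<times> real) set \<Rightarrow> 'n::finite heis set" where
  "revolve \<Gamma> = {(r *\<^sub>R \<omega>, h) | r h \<omega>. (r, h) \<in> \<Gamma> \<and> \<omega> \<in> sphere 0 1}"

definition rev_map :: "(real \<Rightarrow> real) \<Rightarrow> (real \<Rightarrow> real) \<Rightarrow> real \<times> (complex ^ 'n) \<Rightarrow> 'n::finite heis" where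
  "rev_map x t = (\<lambda>(s, \<omega>). (x s *\<^sub>R \<omega>, t s))"

definition off_axis :: "(real \<Rightarrow> real) \<Rightarrow> real set \<Rightarrow> real set" where
  "off_axis x I = {s \<in> I. 0 < x s}"

text \<open>
  The curve \<open>s \<mapsto> (x s, t s)\<close> on \<open>I\<close> is parametrized by arc length with angle function \<open>\<sigma>\<close>. Off the
  axis it is twice continuously differentiable, which is expressed by \<open>\<sigma>\<close> being continuously
  differentiable; no regularity of \<open>\<sigma>\<close> is imposed at points of the axis.
\<close>

definition generating_curve ::
  "real set \<Rightarrow> (real \<Rightarrow> real) \<Rightarrow> (real \<Rightarrow> real) \<Rightarrow> (real \<Rightarrow> real) \<Rightarrow> bool" where
  "generating_curve I x t \<sigma> \<longleftrightarrow>
     is_interval I \<and>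
     (\<forall>s\<in>I. 0 \<le> x s \<and>
        (x has_real_derivative sin (\<sigma> s)) (at s within I) \<and>
        (t has_real_derivative cos (\<sigma> s)) (at s within I)) \<and>
     (\<exists>\<kappa>. continuous_on (off_axis x I) \<kappa> \<and>
        (\<forall>s\<in>off_axis x I. (\<sigma> has_real_derivative \<kappa> s) (at s within I)))"

text \<open>
  Minimality is tested on the part off the axis and over the interior of \<open>I\<close>, where \<open>rev_map\<close> is an
  immersion. By rotational symmetry the normal at a regular point of the axis is vertical, so that
  such points are singular; at end points of \<open>I\<close> off the axis the condition follows by continuity.
\<close>

definition minimal_revolution ::
  "'n::finite itself \<Rightarrow> real set \<Rightarrow> (real \<Rightarrow> real) \<Rightarrow> (real \<Rightarrow> real) \<Rightarrow> bool" where
  "minimal_revolution n I x t \<longleftrightarrow>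
     minimal_hypersurface (rev_map x t :: real \<times> (complex ^ 'n) \<Rightarrow> 'n heis)
       (off_axis x (interior I) \<times> sphere 0 1)"

text \<open>
  The profile system for minimal hypersurfaces of revolution. Solutions are taken on open intervals,
  which is no restriction for non-extendable solutions.
\<close>

definition profile_solution ::
  "nat \<Rightarrow> real set \<Rightarrow> (real \<Rightarrow> real) \<Rightarrow> (real \<Rightarrow> real) \<Rightarrow> (real \<Rightarrow> real) \<Rightarrow> bool" where
  "profile_solution n J x t \<sigma> \<longleftrightarrow>
     open J \<and> is_interval J \<and> J \<noteq> {} \<and>
     (\<forall>s\<in>J. 0 < x s \<and>
        (x has_real_derivative sin (\<sigma> s)) (at s) \<and>
        (t has_real_derivative cos (\<sigma> s)) (at s) \<and>
        (\<sigma> has_real_derivative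
           (2 * real n - 1) * (cos (\<sigma> s)) ^ 3 / (x s) ^ 3
           + 2 * (real n - 1) * ((sin (\<sigma> s))\<^sup>2 * cos (\<sigma> s)) / x s) (at s))"

definition maximal_profile_solution ::
  "nat \<Rightarrow> real set \<Rightarrow> (real \<Rightarrow> real) \<Rightarrow> (real \<Rightarrow> real) \<Rightarrow> (real \<Rightarrow> real) \<Rightarrow> bool" where
  "maximal_profile_solution n J x t \<sigma> \<longleftrightarrow>
     profile_solution n J x t \<sigma> \<and>
     (\<forall>J' x' t' \<sigma>'. profile_solution n J' x' t' \<sigma>' \<longrightarrow> J \<subseteq> J' \<longrightarrow>
        (\<forall>s\<in>J. x' s = x s \<and> t' s = t s \<and> \<sigma>' s = \<sigma> s) \<longrightarrow> J' = J)"

text \<open>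
  The second conjunct says that the points of the curve on the axis are exactly the limit points
  on the axis of the part of the curve off the axis.
\<close>

definition complete_generating_curve ::
  "nat \<Rightarrow> real set \<Rightarrow> (real \<Rightarrow> real) \<Rightarrow> (real \<Rightarrow> real) \<Rightarrow> (real \<Rightarrow> real) \<Rightarrow> bool" where
  "complete_generating_curve n I x t \<sigma> \<longleftrightarrow>
     maximal_profile_solution n (off_axis x I) x t \<sigma> \<and>
     (\<lambda>s. (x s, t s)) ` {s \<in> I. x s = 0} =
       {p \<in> closure ((\<lambda>s. (x s, t s)) ` off_axis x I). fst p = 0}"

definition complete_minimal_revolution :: "'n::finite heis set \<Rightarrow> bool" where
  "complete_minimal_revolution \<Sigma> \<longleftrightarrow>
     (\<exists>I x t \<sigma>. generating_curve I x t \<sigma> \<and>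
        \<Sigma> = revolve ((\<lambda>s. (x s, t s)) ` I) \<and>
        minimal_revolution TYPE('n) I x t \<and>
        complete_generating_curve CARD('n) I x t \<sigma>)"

definition hyperplane_orthogonal_to_t_axis :: "'n::finite heis set \<Rightarrow> bool" where
  "hyperplane_orthogonal_to_t_axis \<Sigma> \<longleftrightarrow> (\<exists>c. \<Sigma> = {p. (0, 1) \<bullet> p = c})"

definition strictly_convex_on :: "real set \<Rightarrow> (real \<Rightarrow> real) \<Rightarrow> bool" where
  "strictly_convex_on D f \<longleftrightarrow> convex D \<and>
     (\<forall>u\<in>D. \<forall>v\<in>D. \<forall>\<mu>. u \<noteq> v \<longrightarrow> 0 < \<mu> \<longrightarrow> \<mu> < 1 \<longrightarrow>
        f ((1 - \<mu>) * u + \<mu> * v) < (1 - \<mu>) * f u + \<mu> * f v)"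

definition C2_on :: "real set \<Rightarrow> (real \<Rightarrow> real) \<Rightarrow> bool" where
  "C2_on D f \<longleftrightarrow> (\<exists>f' f''. continuous_on D f'' \<and>
     (\<forall>u\<in>D. (f has_real_derivative f' u) (at u) \<and> (f' has_real_derivative f'' u) (at u)))"

text \<open>The number \<open>c\<close> is the height of the translation along the axis.\<close>

definition catenoidal_type :: "'n::finite heis set \<Rightarrow> bool" where
  "catenoidal_type \<Sigma> \<longleftrightarrow>
     (\<exists>(a::ereal) c f. 0 < a \<and>
        (\<forall>u\<in>einterval (- a) a. 0 < f u \<and> f (- u) = f u) \<and>
        strictly_convex_on (einterval (- a) a) f \<and>
        C2_on (einterval (- a) a) f \<and>
        filterlim (f \<circ> real_of_ereal) at_top (at_left a) \<and>
        filterlim (f \<circ> real_of_ereal) at_top (at_right (- a)) \<and>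
        \<Sigma> = revolve ((\<lambda>u. (f u, u + c)) ` einterval (- a) a))"

end

theory Submission
  imports Defs
begin

text \<open>
  By the definition of completeness the part of the generating curve off the axis is a
  non-extendable solution of the profile system, so the theorem is a statement about that system.
  Put \<open>m = 2 n - 1\<close>. The quantity
  \<open>Q = x\<^sup>2\<^sup>m cos\<^sup>2 \<sigma> / (cos\<^sup>2 \<sigma> + x\<^sup>2 sin\<^sup>2 \<sigma>)\<close> is constant along every solution
  (\<open>profile_first_integral\<close>), and it vanishes exactly where \<open>cos \<sigma>\<close> does. Hence either
  \<open>cos \<sigma>\<close> vanishes identically or it has no zero.

  If \<open>cos \<sigma> = 0\<close> throughout, then \<open>t\<close> is constant and \<open>x\<close> is affine with derivative \<open>\<plusminus>1\<close>, so the
  non-extendable curve is an open half-line orthogonal to the axis. Its end point on the axis is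
  adjoined, and the surface is a hyperplane (\<open>maximal_profile_orthogonal_to_axis\<close>).

  If \<open>cos \<sigma>\<close> has no zero, a reflection in \<open>t\<close> makes it positive, and the curve is a graph over an
  interval of the \<open>t\<close>-axis with \<open>dx/dt = tan \<sigma>\<close>. The parameter \<open>w\<close> with \<open>sinh w = x tan \<sigma>\<close> then makes
  everything explicit: constancy of \<open>Q\<close> reads \<open>x\<^sup>m = const * cosh w\<close>, and height and arc length become
  primitives of explicit positive functions of \<open>w\<close>. These formulas make sense for all real \<open>w\<close>,
  and so they define a model curve of which the given solution is a piece
  (\<open>transverse_profile_is_model\<close>). The model solves the profile system too
  (\<open>profile_solution_model\<close>), so a non-extendable solution is the whole model. Finally the
  model is of catenoidal type (\<open>catenoidal_type_model\<close>): the radius is even in \<open>w\<close> and tends to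
  infinity, the height is odd and increasing, and the second derivative of the radius with respect
  to the height is positive. Since the radius is bounded below by its value at the neck \<open>w = 0\<close>,
  the curve has no limit point on the axis and nothing is adjoined.
\<close>

section \<open>Increasing functions on the real line\<close>

lemma integral_from_0_has_derivative:
  fixes g :: "real \<Rightarrow> real"
  assumes "continuous_on UNIV g"
  shows "((\<lambda>u. LBINT v=0..u. g v) has_real_derivative g w) (at w)"
proof -
  define b where "b = \<bar>w\<bar> + 1"
  have "((\<lambda>u. LBINT v=ereal 0..u. g v) has_vector_derivative g w) (at w within {- b..b})"
    by (rule interval_integral_FTC2)
      (use assms in \<open>auto simp: b_def intro: continuous_on_subset\<close>)
  moreover have "at w within {- b..b} = at w"
    by (rule at_within_interior) (auto simp: b_def)
  ultimately show ?thesis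
    by (simp add: has_real_derivative_iff_has_vector_derivative zero_ereal_def)
qed

lemma positive_derivative_inverse:
  fixes F F' :: "real \<Rightarrow> real"
  assumes F: "\<And>w. (F has_real_derivative F' w) (at w)" and pos: "\<And>w. 0 < F' w"
  shows "strict_mono F" and "open (range F)" and "is_interval (range F)"
    and "(inv F has_real_derivative inverse (F' w)) (at (F w))"
proof -
  show mono: "strict_mono F"
    by (rule strict_monoI, rule DERIV_pos_imp_increasing) (use F pos in blast)+
  have cont: "continuous_on UNIV F"
    using F by (meson DERIV_isCont continuous_at_imp_continuous_on)
  have inj: "inj F" using mono by (rule strict_mono_imp_inj_on)
  show "open (range F)"
    using injective_eq_1d_open_map_UNIV[OF cont] inj by simp
  show "is_interval (range F)"
    using cont by (simp add: is_interval_connected_1 connected_continuous_image)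
  have "F' w \<noteq> 0" using pos[of w] by simp
  then show "(inv F has_real_derivative inverse (F' w)) (at (F w))"
    using has_derivative_inverse_strong[of UNIV w F "inv F" "(*) (F' w)" "(*) (inverse (F' w))"]
      F[of w] inj cont by (simp add: has_field_derivative_def fun_eq_iff)
qed

text \<open>
  This supplies the extended real half-width of the interval over which the catenary is a graph:
  it is the supremum of the height, finite or not.
\<close>

lemma range_odd_strict_mono:
  fixes F :: "real \<Rightarrow> real"
  assumes cont: "continuous_on UNIV F" and mono: "strict_mono F" and odd: "\<And>w. F (- w) = - F w"
  obtains a :: ereal where "0 < a" "einterval (- a) a = range F"
proof
  let ?a = "SUP w. ereal (F w)"
  have lt: "ereal (F w) < ?a" for w
    using strict_monoD[OF mono, of w "w + 1"] by (auto simp: less_SUP_iff)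
  have "F 0 = 0" using odd[of 0] by simp
  then show "0 < ?a" using lt[of 0] by (simp add: zero_ereal_def)
  show "einterval (- ?a) ?a = range F"
  proof (intro equalityI subsetI)
    fix y assume y: "y \<in> einterval (- ?a) ?a"
    then obtain v where v: "y < F v" by (auto simp: einterval_iff less_SUP_iff)
    have "ereal (- y) < ?a" using y by (simp add: einterval_iff ereal_uminus_less_reorder)
    then obtain u where "- y < F u" by (auto simp: less_SUP_iff)
    then have u: "F (- u) < y" by (simp add: odd)
    have "- u \<le> v"
      using u v strict_mono_less[OF mono, of "- u" v] by linarith
    then have "\<exists>w. - u \<le> w \<and> w \<le> v \<and> F w = y"
      using u v by (intro IVT') (auto intro: continuous_on_subset[OF cont])
    then show "y \<in> range F" by auto
  next
    fix y assume "y \<in> range F"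
    then obtain w where w: "y = F w" by auto
    have "- ?a < ereal y"
      using lt[of "- w"] by (simp add: w odd ereal_uminus_less_reorder)
    then show "y \<in> einterval (- ?a) ?a"
      using lt[of w] by (simp add: w einterval_iff)
  qed
qed

lemma strictly_convex_on_second_derivative:
  assumes D: "is_interval D"
    and f: "\<And>u. u \<in> D \<Longrightarrow> (f has_real_derivative f' u) (at u)"
    and f': "\<And>u. u \<in> D \<Longrightarrow> (f' has_real_derivative f'' u) (at u)"
    and pos: "\<And>u. u \<in> D \<Longrightarrow> 0 < f'' u"
  shows "strictly_convex_on D f"
proof -
  have less: "f ((1 - \<mu>) * u + \<mu> * v) < (1 - \<mu>) * f u + \<mu> * f v"
    if uv: "u \<in> D" "v \<in> D" "u < v" and \<mu>: "0 < \<mu>" "\<mu> < 1" for u v \<mu>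
  proof -
    define z where "z = (1 - \<mu>) * u + \<mu> * v"
    have zu: "z - u = \<mu> * (v - u)" and vz: "v - z = (1 - \<mu>) * (v - u)"
      by (simp_all add: z_def algebra_simps)
    have "0 < z - u" "0 < v - z" unfolding zu vz using uv \<mu> by simp_all
    then have z: "u < z" "z < v" by simp_all
    have inD: "y \<in> D" if "u \<le> y" "y \<le> v" for y
      using D uv that by (meson mem_is_interval_1_I)
    obtain p where p: "u < p" "p < z" "f z - f u = (z - u) * f' p"
      using MVT2[of u z f f'] f z inD by (meson less_imp_le order_trans)
    obtain q where q: "z < q" "q < v" "f v - f z = (v - z) * f' q"
      using MVT2[of z v f f'] f z inD by (meson less_imp_le order_trans)
    have "f' p < f' q"
    proof (rule DERIV_pos_imp_increasing[where f = f'])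
      show "p < q" using p q by simp
      fix y assume "p \<le> y" "y \<le> q"
      then have "y \<in> D" using p q by (intro inD) simp_all
      then show "\<exists>l. (f' has_real_derivative l) (at y) \<and> 0 < l" using f' pos by blast
    qed
    moreover have "0 < \<mu> * (1 - \<mu>) * (v - u)" using uv \<mu> by simp
    ultimately have "0 < (\<mu> * (1 - \<mu>) * (v - u)) * (f' q - f' p)" by simp
    also have "\<dots> = \<mu> * (f v - f z) - (1 - \<mu>) * (f z - f u)"
      by (simp add: p(3) q(3) zu vz algebra_simps)
    finally show ?thesis unfolding z_def[symmetric] by (simp add: algebra_simps)
  qed
  have "f ((1 - \<mu>) * u + \<mu> * v) < (1 - \<mu>) * f u + \<mu> * f v"
    if "u \<in> D" "v \<in> D" "u \<noteq> v" "0 < \<mu>" "\<mu> < 1" for u v \<mu>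
    using less[of u v \<mu>] less[of v u "1 - \<mu>"] that by (cases "u < v") (auto simp: add.commute)
  then show ?thesis
    using D by (simp add: strictly_convex_on_def is_interval_convex)
qed

section \<open>The model catenoids\<close>

text \<open>
  In terms of \<open>w\<close>, where \<open>sinh w\<close> is the radius times the slope \<open>dx/dt\<close>, the first integral says
  that the \<open>m\<close>-th power of the radius is \<open>exp c * cosh w\<close>; the parameter \<open>c\<close> fixes the size of the
  neck. The equation \<open>x'' = m / x\<^sup>3 + (m - 1) x'\<^sup>2 / x\<close> for the radius as a function of the height
  becomes \<open>dw/dt = m cosh w / x\<^sup>2\<close>, whence the integrands for height and arc length.
\<close>

definition radius :: "real \<Rightarrow> real \<Rightarrow> real \<Rightarrow> real" where
  "radius m c w = exp ((ln (cosh w) + c) / m)"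

definition slope :: "real \<Rightarrow> real \<Rightarrow> real \<Rightarrow> real" where
  "slope m c w = sinh w / radius m c w"

definition height :: "real \<Rightarrow> real \<Rightarrow> real \<Rightarrow> real" where
  "height m c w = (LBINT v=0..w. (radius m c v)\<^sup>2 / (m * cosh v))"

definition arclength :: "real \<Rightarrow> real \<Rightarrow> real \<Rightarrow> real" where
  "arclength m c w =
     (LBINT v=0..w. sqrt (1 + (slope m c v)\<^sup>2) * ((radius m c v)\<^sup>2 / (m * cosh v)))"

lemma radius_pos [simp]: "0 < radius m c w"
  by (simp add: radius_def)

lemma radius_nonzero [simp]: "radius m c w \<noteq> 0"
  by (simp add: radius_def)

lemma radius_minus [simp]: "radius m c (- w) = radius m c w"
  by (simp add: radius_def)

lemma continuous_on_radius [continuous_intros]: "continuous_on S (radius m c)"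
  unfolding radius_def by (cases "m = 0") (auto intro!: continuous_intros)

lemma continuous_on_slope [continuous_intros]: "continuous_on S (slope m c)"
  unfolding slope_def by (auto intro!: continuous_intros)

lemma DERIV_radius:
  "(radius m c has_real_derivative radius m c w * (sinh w / (m * cosh w))) (at w)"
  unfolding radius_def by (cases "m = 0") (auto intro!: derivative_eq_intros)

lemma DERIV_slope:
  assumes "m \<noteq> 0"
  shows "(slope m c has_real_derivative
    (m + (m - 1) * (sinh w)\<^sup>2) / (m * cosh w * radius m c w)) (at w)"
proof -
  have "(sinh has_real_derivative cosh w) (at w)"
    by (auto intro!: derivative_eq_intros)
  from DERIV_divide[OF this DERIV_radius]
  have "(slope m c has_real_derivative
      (cosh w * radius m c w - sinh w * (radius m c w * (sinh w / (m * cosh w))))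
        / (radius m c w * radius m c w)) (at w)"
    by (simp add: slope_def[abs_def])
  moreover have "(cosh w * radius m c w - sinh w * (radius m c w * (sinh w / (m * cosh w))))
        / (radius m c w * radius m c w)
      = (m * (cosh w)\<^sup>2 - (sinh w)\<^sup>2) / (m * cosh w * radius m c w)"
    using assms by (simp add: field_simps power2_eq_square)
  moreover have "m * (cosh w)\<^sup>2 - (sinh w)\<^sup>2 = m + (m - 1) * (sinh w)\<^sup>2"
    by (simp add: cosh_square_eq algebra_simps)
  ultimately show ?thesis by (simp only:)
qed

lemma DERIV_height:
  assumes "m \<noteq> 0"
  shows "(height m c has_real_derivative (radius m c w)\<^sup>2 / (m * cosh w)) (at w)"
  unfolding height_def
  by (rule integral_from_0_has_derivative) (use assms in \<open>auto intro!: continuous_intros\<close>)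

lemma DERIV_arclength:
  assumes "m \<noteq> 0"
  shows "(arclength m c has_real_derivative
    sqrt (1 + (slope m c w)\<^sup>2) * ((radius m c w)\<^sup>2 / (m * cosh w))) (at w)"
  unfolding arclength_def
  by (rule integral_from_0_has_derivative) (use assms in \<open>auto intro!: continuous_intros\<close>)

text \<open>
  The integrand is even and the height vanishes at \<open>w = 0\<close>.
\<close>

lemma height_minus:
  assumes "m \<noteq> 0"
  shows "height m c (- w) = - height m c w"
proof -
  have "((\<lambda>w. height m c w + height m c (- w)) has_real_derivative 0) (at w)" for w
    by (rule derivative_eq_intros DERIV_chain2[OF DERIV_height] DERIV_height assms refl)+ simp
  then obtain k where "\<forall>w. height m c w + height m c (- w) = k"
    using has_field_derivative_zero_constant[of UNIV "\<lambda>w. height m c w + height m c (- w)"] by auto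
  moreover have "height m c 0 = 0" by (simp add: height_def zero_ereal_def[symmetric])
  ultimately have "height m c w + height m c (- w) = 0"
    by (metis add_0 minus_zero)
  then show ?thesis by simp
qed

lemma radius_unbounded:
  assumes "0 < m"
  obtains v where "\<And>w. v < \<bar>w\<bar> \<Longrightarrow> K \<le> radius m c w"
proof -
  have "filterlim (\<lambda>w. (1 / m) * (c + ln (cosh w))) at_top at_top"
    using assms
    by (intro filterlim_tendsto_pos_mult_at_top[OF tendsto_const]
        filterlim_tendsto_add_at_top[OF tendsto_const]
        filterlim_compose[OF ln_at_top cosh_real_at_top]) simp
  then have "filterlim (radius m c) at_top at_top"
    unfolding radius_def[abs_def] by (intro filterlim_compose[OF exp_at_top]) (simp add: add.commute)
  then obtain v where v: "\<And>w. v \<le> w \<Longrightarrow> K \<le> radius m c w"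
    by (auto simp: filterlim_at_top eventually_at_top_linorder)
  show thesis
  proof
    fix w :: real assume "v < \<bar>w\<bar>"
    then have "K \<le> radius m c \<bar>w\<bar>" by (intro v) simp
    then show "K \<le> radius m c w" by (simp add: radius_def)
  qed
qed

text \<open>
  The graph function is the radius composed with the inverse of the height. By the chain rule its
  first derivative is the slope and its second derivative is \<open>(m + (m - 1) sinh\<^sup>2 w) / x\<^sup>3\<close>, which is
  positive because \<open>m \<ge> 1\<close>.
\<close>

lemma catenoidal_type_model:
  assumes m: "1 \<le> m"
  shows "catenoidal_type (revolve (range (\<lambda>w. (radius m c w, height m c w + d))) :: 'n::finite heis set)"
proof -
  let ?h = "height m c" and ?W = "inv (height m c)"
  define f where "f = (\<lambda>u. radius m c (?W u))"
  define f'' where "f'' = (\<lambda>w. (m + (m - 1) * (sinh w)\<^sup>2) / (radius m c w) ^ 3)"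
  have m0: "m \<noteq> 0" using m by simp
  have pos: "0 < (radius m c w)\<^sup>2 / (m * cosh w)" for w using m by simp
  note inv = positive_derivative_inverse[OF DERIV_height[OF m0, of c] pos]
  have cont: "continuous_on UNIV ?h"
    using DERIV_height[OF m0, of c] by (meson DERIV_isCont continuous_at_imp_continuous_on)
  have W [simp]: "?W (?h w) = w" for w
    using inv(1) by (simp add: strict_mono_imp_inj_on)
  obtain a where a: "0 < a" "einterval (- a) a = range ?h"
    using range_odd_strict_mono[OF cont inv(1) height_minus[OF m0]] by blast
  have W_odd: "?W (- u) = - ?W u" if "u \<in> einterval (- a) a" for u
    using that by (auto simp: a(2) height_minus[OF m0, symmetric])
  have f1: "(f has_real_derivative slope m c (?W u)) (at u)" if "u \<in> range ?h" for u
  proof -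
    obtain w where u: "u = ?h w" using \<open>u \<in> range ?h\<close> by (rule rangeE)
    show ?thesis unfolding f_def u
      by (rule DERIV_cong[OF DERIV_chain2[OF DERIV_radius inv(4)]])
        (use m0 in \<open>simp add: slope_def field_simps power2_eq_square\<close>)
  qed
  have f2: "((\<lambda>u. slope m c (?W u)) has_real_derivative f'' (?W u)) (at u)" if "u \<in> range ?h" for u
  proof -
    obtain w where u: "u = ?h w" using \<open>u \<in> range ?h\<close> by (rule rangeE)
    show ?thesis unfolding u f''_def
      by (rule DERIV_cong[OF DERIV_chain2[OF DERIV_slope[OF m0] inv(4)]])
        (use m0 in \<open>simp add: field_simps power2_eq_square power3_eq_cube\<close>)
  qed
  have f''_pos: "0 < f'' w" for w
    using m unfolding f''_def by (intro divide_pos_pos add_pos_nonneg) auto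
  have "continuous_on (range ?h) ?W"
    using DERIV_isCont[OF inv(4)] by (auto intro: continuous_at_imp_continuous_on)
  moreover have "continuous_on UNIV f''"
    unfolding f''_def by (auto intro!: continuous_intros)
  ultimately have "continuous_on (range ?h) (\<lambda>u. f'' (?W u))"
    using continuous_on_compose2[of UNIV f'' "range ?h" ?W] by simp
  then have C2: "C2_on (einterval (- a) a) f"
    unfolding C2_on_def a(2)
    by (intro exI[of _ "\<lambda>u. slope m c (?W u)"] exI[of _ "\<lambda>u. f'' (?W u)"] conjI ballI f1 f2)
  have convex: "strictly_convex_on (einterval (- a) a) f"
    unfolding a(2) by (rule strictly_convex_on_second_derivative[OF inv(3) f1 f2 f''_pos])
  have in_range: "- a < ereal (?h w) \<and> ereal (?h w) < a" for w
    unfolding einterval_iff[symmetric] a(2) by simp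
  \<comment> \<open>Both ends at once: the radius is large as soon as the absolute value of \<open>w\<close> is, that is,
    for heights near either end of the interval.\<close>
  have ends: "\<exists>b < a. \<forall>y. (b < y \<and> y < a \<longrightarrow> K \<le> f (real_of_ereal y)) \<and>
      (- a < y \<and> y < - b \<longrightarrow> K \<le> f (real_of_ereal y))" for K
  proof -
    obtain v where v: "\<And>w. v < \<bar>w\<bar> \<Longrightarrow> K \<le> radius m c w"
      using radius_unbounded[of m K c] m by auto
    have b: "ereal (?h v) < a" using in_range by simp
    have "K \<le> f (real_of_ereal y)"
      if y: "ereal (?h v) < y \<and> y < a \<or> - a < y \<and> y < - ereal (?h v)" for y
    proof -
      have "- a < ereal (?h v)" "- a < ereal (- ?h v)" "ereal (- ?h v) < a"
        using b in_range[of v] in_range[of "- v"] by (simp_all add: height_minus[OF m0])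
      then have "- a < y \<and> y < a \<and> y \<noteq> \<infinity> \<and> y \<noteq> - \<infinity>"
        using y by (cases y; cases a) auto
      then obtain r where r: "y = ereal r" "r \<in> range ?h"
        unfolding a(2)[symmetric] by (cases y) (auto simp: einterval_iff)
      then obtain w where w: "r = ?h w" by (auto elim: rangeE)
      have "?h v < ?h w \<or> ?h w < ?h (- v)"
        using y by (auto simp: r(1) w height_minus[OF m0])
      then have "v < \<bar>w\<bar>"
        by (auto simp: strict_mono_less[OF inv(1)])
      then show ?thesis by (simp add: f_def r(1) w v)
    qed
    then show ?thesis using b by blast
  qed
  have left: "filterlim (f \<circ> real_of_ereal) at_top (at_left a)"
    unfolding filterlim_at_top
  proof
    fix K show "\<forall>\<^sub>F y in at_left a. K \<le> (f \<circ> real_of_ereal) y"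
      using ends[of K] a(1) by (subst eventually_at_left[of 0 a]) auto
  qed
  have right: "filterlim (f \<circ> real_of_ereal) at_top (at_right (- a))"
    unfolding filterlim_at_top
  proof
    fix K
    obtain b where "b < a" "\<forall>y. - a < y \<and> y < - b \<longrightarrow> K \<le> f (real_of_ereal y)"
      using ends[of K] by blast
    moreover have "- a < 0" using a(1) by (cases a) auto
    ultimately show "\<forall>\<^sub>F y in at_right (- a). K \<le> (f \<circ> real_of_ereal) y"
      unfolding eventually_at_right[OF \<open>- a < 0\<close>] by (intro exI[of _ "- b"]) simp
  qed
  have even: "\<forall>u\<in>einterval (- a) a. 0 < f u \<and> f (- u) = f u"
    using W_odd by (simp add: f_def)
  have "range (\<lambda>w. (radius m c w, ?h w + d)) = (\<lambda>u. (f u, u + d)) ` einterval (- a) a"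
    unfolding a(2) by (simp add: f_def image_image)
  then show ?thesis
    unfolding catenoidal_type_def
    by (intro exI[of _ a] exI[of _ d] exI[of _ f] conjI a(1) even convex C2 left right) (simp only:)
qed

section \<open>Solutions of the profile system\<close>

text \<open>
  For the radius as a function of the height, with slope \<open>p = tan \<sigma>\<close>, the profile system is a linear
  equation for \<open>p\<^sup>2\<close> as a function of \<open>x\<close>, with general solution \<open>p\<^sup>2 = C x\<^bsup>2m-2\<^esup> - x\<^bsup>-2\<^esup>\<close>. Solving
  for \<open>1 / C\<close> and clearing \<open>cos \<sigma>\<close> from the denominators gives a quantity that is smooth also
  where \<open>dt/ds = cos \<sigma>\<close> is zero, and that detects these points by vanishing there. The exponential stands
  for \<open>x\<^sup>2\<^sup>m\<close>.
\<close>

lemma profile_first_integral: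
  assumes sol: "profile_solution n J x t \<sigma>" and m: "m = 2 * real n - 1"
  shows "\<exists>Q. \<forall>s\<in>J.
    exp (2 * m * ln (x s)) * (cos (\<sigma> s))\<^sup>2 / ((cos (\<sigma> s))\<^sup>2 + (x s)\<^sup>2 * (sin (\<sigma> s))\<^sup>2) = Q"
proof -
  let ?Q = "\<lambda>s. exp (2 * m * ln (x s)) * (cos (\<sigma> s))\<^sup>2 / ((cos (\<sigma> s))\<^sup>2 + (x s)\<^sup>2 * (sin (\<sigma> s))\<^sup>2)"
  have "(?Q has_real_derivative 0) (at s)" if s: "s \<in> J" for s
  proof -
    define X S C where "X = x s" "S = sin (\<sigma> s)" "C = cos (\<sigma> s)"
    define k where "k = m * C ^ 3 / X ^ 3 + (m - 1) * (S\<^sup>2 * C) / X"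
    define D where "D = C\<^sup>2 + X\<^sup>2 * S\<^sup>2"
    have X: "0 < X" and dx: "(x has_real_derivative S) (at s)"
      and d\<sigma>: "(\<sigma> has_real_derivative k) (at s)"
      using sol s by (auto simp: profile_solution_def X_S_C_def k_def m algebra_simps)
    have SC: "S\<^sup>2 + C\<^sup>2 = 1" by (simp add: X_S_C_def)
    have D: "D \<noteq> 0"
    proof
      assume "D = 0"
      then have "C = 0" "X * S = 0"
        by (auto simp: D_def power_mult_distrib[symmetric] sum_power2_eq_zero_iff)
      then show False using X SC by simp
    qed
    have k: "X\<^sup>2 * k = m * C ^ 3 / X + (m - 1) * (S\<^sup>2 * C) * X"
      using X by (simp add: k_def field_simps power2_eq_square power3_eq_cube)
    \<comment> \<open>Up to the factor \<open>2 E C S\<close>, with \<open>E\<close> the power of the radius, the left-hand side is the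
      numerator of the derivative.\<close>
    have "m * C * D / X - k * D + C\<^sup>2 * k - C * X * S\<^sup>2 - X\<^sup>2 * C\<^sup>2 * k
        = m * C * D / X - (S\<^sup>2 + C\<^sup>2) * (X\<^sup>2 * k) - C * X * S\<^sup>2 + (C\<^sup>2 * k) * (1 - 1)"
      by (simp add: D_def algebra_simps)
    also have "\<dots> = 0"
      unfolding SC k D_def using X by (simp add: field_simps power2_eq_square power3_eq_cube)
    finally have zero: "m * C * D / X - k * D + C\<^sup>2 * k - C * X * S\<^sup>2 - X\<^sup>2 * C\<^sup>2 * k = 0" .
    define E where "E = exp (2 * m * ln X)"
    have "((\<lambda>s. exp (2 * m * ln (x s))) has_real_derivative E * (2 * m * S / X)) (at s)"
      using X by (auto intro!: derivative_eq_intros dx simp: E_def X_S_C_def)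
    moreover have "((\<lambda>s. (cos (\<sigma> s))\<^sup>2) has_real_derivative - (2 * C * S * k)) (at s)"
      by (auto intro!: derivative_eq_intros d\<sigma> simp: X_S_C_def)
    moreover have "((\<lambda>s. (cos (\<sigma> s))\<^sup>2 + (x s)\<^sup>2 * (sin (\<sigma> s))\<^sup>2) has_real_derivative
        2 * S * (- C * k + X * S\<^sup>2 + X\<^sup>2 * C * k)) (at s)"
      by (rule derivative_eq_intros dx d\<sigma> refl)+ (simp add: X_S_C_def algebra_simps power2_eq_square)
    ultimately have "(?Q has_real_derivative
        ((E * (2 * m * S / X) * C\<^sup>2 + - (2 * C * S * k) * E) * D
          - E * C\<^sup>2 * (2 * S * (- C * k + X * S\<^sup>2 + X\<^sup>2 * C * k))) / (D * D)) (at s)"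
      using D unfolding D_def E_def X_S_C_def by (intro DERIV_divide DERIV_mult)
    moreover have "(E * (2 * m * S / X) * C\<^sup>2 + - (2 * C * S * k) * E) * D
          - E * C\<^sup>2 * (2 * S * (- C * k + X * S\<^sup>2 + X\<^sup>2 * C * k))
        = 2 * E * C * S * (m * C * D / X - k * D + C\<^sup>2 * k - C * X * S\<^sup>2 - X\<^sup>2 * C\<^sup>2 * k)"
      using X by (simp add: field_simps power2_eq_square)
    ultimately show ?thesis by (simp add: zero)
  qed
  then show ?thesis
    using sol by (intro has_field_derivative_zero_constant)
      (auto simp: profile_solution_def is_interval_convex intro: has_field_derivative_at_within)
qed

text \<open>
  The radius is read off from the first integral. For height, arc length and angle, the difference
  between the solution and the model at the parameter \<open>w\<close> has derivative zero, because
  \<open>dw/ds = m cos \<sigma> cosh w / x\<^sup>2\<close>. The constant \<open>\<theta>\<close> is a multiple of \<open>2 \<pi>\<close>: the angle lies in some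
  branch of the tangent on which the cosine is positive.
\<close>

lemma transverse_profile_is_model:
  assumes sol: "profile_solution n J x t \<sigma>" and n: "1 \<le> n" and m: "m = 2 * real n - 1"
    and pos: "\<And>s. s \<in> J \<Longrightarrow> 0 < cos (\<sigma> s)"
  shows "\<exists>c \<delta> d \<theta> w. sin \<theta> = 0 \<and> cos \<theta> = 1 \<and>
    (\<forall>s\<in>J. s = arclength m c (w s) + \<delta> \<and> x s = radius m c (w s) \<and>
      t s = height m c (w s) + d \<and> \<sigma> s = arctan (slope m c (w s)) + \<theta>)"
proof -
  have m0: "0 < m" "m \<noteq> 0" using n m by auto
  obtain Q where Q: "\<And>s. s \<in> J \<Longrightarrow>
    exp (2 * m * ln (x s)) * (cos (\<sigma> s))\<^sup>2 / ((cos (\<sigma> s))\<^sup>2 + (x s)\<^sup>2 * (sin (\<sigma> s))\<^sup>2) = Q"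
    using profile_first_integral[OF sol m] by blast
  define w where "w = (\<lambda>s. arsinh (x s * tan (\<sigma> s)))"
  define c where "c = ln Q / 2"
  have J: "convex J" "J \<noteq> {}"
    using sol by (auto simp: profile_solution_def is_interval_convex)
  have const: "\<exists>k. \<forall>s\<in>J. g s = k"
    if "\<And>s. s \<in> J \<Longrightarrow> (g has_real_derivative 0) (at s)" for g
    using J that by (intro has_field_derivative_zero_constant) (auto intro: has_field_derivative_at_within)
  have x: "0 < x s" "(x has_real_derivative sin (\<sigma> s)) (at s)"
    and dt: "(t has_real_derivative cos (\<sigma> s)) (at s)"
    and d\<sigma>: "(\<sigma> has_real_derivative
           m * (cos (\<sigma> s)) ^ 3 / (x s) ^ 3 + (m - 1) * ((sin (\<sigma> s))\<^sup>2 * cos (\<sigma> s)) / x s) (at s)"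
    if "s \<in> J" for s
    using sol that by (auto simp: profile_solution_def m algebra_simps)
  have cosh2: "(cosh (w s))\<^sup>2 = (x s * tan (\<sigma> s))\<^sup>2 + 1" for s
    by (simp add: cosh_square_eq w_def)
  have xr: "x s = radius m c (w s)" if s: "s \<in> J" for s
  proof -
    have "(cosh (w s))\<^sup>2 = ((cos (\<sigma> s))\<^sup>2 + (x s)\<^sup>2 * (sin (\<sigma> s))\<^sup>2) / (cos (\<sigma> s))\<^sup>2"
      using pos[OF s] by (simp add: cosh2 tan_def field_simps)
    then have ratio: "exp (2 * m * ln (x s)) / (cosh (w s))\<^sup>2 = Q"
      using Q[OF s] by simp
    have "0 < Q" and "exp (2 * m * ln (x s)) = Q * (cosh (w s))\<^sup>2"
      unfolding ratio[symmetric] by simp_all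
    then have "ln (exp (2 * m * ln (x s))) = ln (Q * (cosh (w s))\<^sup>2)" by (simp only:)
    then have "2 * m * ln (x s) = ln Q + 2 * ln (cosh (w s))"
      using \<open>0 < Q\<close> by (simp add: ln_mult ln_realpow)
    then have "ln (x s) = (ln (cosh (w s)) + c) / m"
      using m0 by (simp add: c_def field_simps)
    then show ?thesis
      using x(1)[OF s] by (metis exp_ln radius_def)
  qed
  have slope: "slope m c (w s) = tan (\<sigma> s)" if s: "s \<in> J" for s
    using x(1)[OF s] by (simp add: slope_def xr[OF s, symmetric]) (simp add: w_def)
  have dw: "(w has_real_derivative m * cos (\<sigma> s) * cosh (w s) / (x s)\<^sup>2) (at s)" if s: "s \<in> J" for s
  proof -
    define X S C where "X = x s" "S = sin (\<sigma> s)" "C = cos (\<sigma> s)"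
    define k where "k = m * C ^ 3 / X ^ 3 + (m - 1) * (S\<^sup>2 * C) / X"
    have X: "0 < X" "0 < C" "tan (\<sigma> s) = S / C"
      using x(1)[OF s] pos[OF s] by (simp_all add: X_S_C_def tan_def)
    have "((\<lambda>s. x s * tan (\<sigma> s)) has_real_derivative S * (S / C) + X * (k / C\<^sup>2)) (at s)"
    proof (rule DERIV_cong[OF DERIV_mult[OF x(2) DERIV_chain2[OF DERIV_tan d\<sigma>]]])
      show "sin (\<sigma> s) * tan (\<sigma> s) + inverse ((cos (\<sigma> s))\<^sup>2)
          * (m * cos (\<sigma> s) ^ 3 / x s ^ 3 + (m - 1) * ((sin (\<sigma> s))\<^sup>2 * cos (\<sigma> s)) / x s) * x s
        = S * (S / C) + X * (k / C\<^sup>2)"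
        unfolding X(3) k_def X_S_C_def by (simp add: divide_inverse)
    qed (use s X in \<open>simp_all add: X_S_C_def\<close>)
    moreover have "S * (S / C) + X * (k / C\<^sup>2) = m * C * (cosh (w s))\<^sup>2 / X\<^sup>2"
      using X(1,2) unfolding cosh2 X(3) X_S_C_def(1)[symmetric]
      by (simp add: k_def field_simps power2_eq_square power3_eq_cube)
    moreover have "sqrt ((x s * tan (\<sigma> s))\<^sup>2 + 1) = cosh (w s)"
      by (simp add: cosh2[symmetric])
    ultimately show ?thesis
      unfolding w_def using X
      by (intro DERIV_cong[OF DERIV_chain2[OF arsinh_real_has_field_derivative]])
        (auto simp: w_def[symmetric] X_S_C_def power2_eq_square)
  qed
  have root: "sqrt (1 + (slope m c (w s))\<^sup>2) = 1 / cos (\<sigma> s)" if s: "s \<in> J" for s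
    using pos[OF s] tan_sec[of "\<sigma> s"]
    by (simp add: slope[OF s] real_sqrt_inverse power_inverse[symmetric] inverse_eq_divide real_sqrt_divide)
  have "((\<lambda>s. t s - height m c (w s)) has_real_derivative 0) (at s)" if s: "s \<in> J" for s
    by (rule DERIV_cong[OF DERIV_diff[OF dt DERIV_chain2[OF DERIV_height dw]]])
      (use s m0 x(1)[OF s] in \<open>simp_all add: xr[OF s, symmetric]\<close>)
  then obtain d where d: "\<forall>s\<in>J. t s - height m c (w s) = d" using const by blast
  have "((\<lambda>s. s - arclength m c (w s)) has_real_derivative 0) (at s)" if s: "s \<in> J" for s
    by (rule DERIV_cong[OF DERIV_diff[OF DERIV_ident DERIV_chain2[OF DERIV_arclength dw]]])
      (use s m0 x(1)[OF s] pos[OF s] in \<open>simp_all add: root[OF s] xr[OF s, symmetric]\<close>)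
  then obtain \<delta> where \<delta>: "\<forall>s\<in>J. s - arclength m c (w s) = \<delta>" using const by blast
  have "((\<lambda>s. \<sigma> s - arctan (tan (\<sigma> s))) has_real_derivative 0) (at s)" if s: "s \<in> J" for s
    using pos[OF s] tan_sec[of "\<sigma> s"]
    by (intro DERIV_cong[OF DERIV_diff[OF d\<sigma>
          DERIV_chain2[OF DERIV_arctan DERIV_chain2[OF DERIV_tan d\<sigma>]]]])
      (use s in \<open>simp_all add: power_inverse\<close>)
  then obtain \<theta> where \<theta>: "\<forall>s\<in>J. \<sigma> s - arctan (tan (\<sigma> s)) = \<theta>" using const by blast
  obtain s0 where s0: "s0 \<in> J" using J by auto
  define \<alpha> where "\<alpha> = arctan (tan (\<sigma> s0))"
  have "cos \<alpha> = cos (\<sigma> s0)"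
    using root[OF s0] by (simp add: \<alpha>_def cos_arctan slope[OF s0])
  moreover have "sin \<alpha> = sin (\<sigma> s0)"
    using root[OF s0] pos[OF s0] by (simp add: \<alpha>_def sin_arctan slope[OF s0] tan_def)
  moreover have "\<theta> = \<sigma> s0 - \<alpha>" using \<theta> s0 by (simp add: \<alpha>_def)
  ultimately have "sin \<theta> = 0" "cos \<theta> = 1"
    by (simp_all add: sin_diff cos_diff power2_eq_square[symmetric])
  moreover have "s = arclength m c (w s) + \<delta> \<and> x s = radius m c (w s) \<and>
      t s = height m c (w s) + d \<and> \<sigma> s = arctan (slope m c (w s)) + \<theta>" if s: "s \<in> J" for s
    using d[rule_format, OF s] \<delta>[rule_format, OF s] \<theta>[rule_format, OF s] xr[OF s] slope[OF s]
    by simp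
  ultimately show ?thesis by blast
qed

text \<open>
  The model as a function of the shifted arc length, in the form needed to compare it with a given
  solution of the system.
\<close>

lemma profile_solution_model:
  fixes c \<delta> d :: real
  assumes n: "1 \<le> n" and m: "m = 2 * real n - 1" and \<theta>: "sin \<theta> = 0" "cos \<theta> = 1"
  defines "F \<equiv> \<lambda>w. arclength m c w + \<delta>"
  shows "inj F"
    and "profile_solution n (range F) (\<lambda>s. radius m c (inv F s)) (\<lambda>s. height m c (inv F s) + d)
      (\<lambda>s. arctan (slope m c (inv F s)) + \<theta>)"
proof -
  have m0: "0 < m" "m \<noteq> 0" using n m by auto
  let ?F' = "\<lambda>w. sqrt (1 + (slope m c w)\<^sup>2) * ((radius m c w)\<^sup>2 / (m * cosh w))"
  have F: "(F has_real_derivative ?F' w) (at w)" for w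
    unfolding F_def using DERIV_arclength[OF m0(2)] by (auto intro!: derivative_eq_intros)
  have root: "0 < sqrt (1 + (slope m c w)\<^sup>2)" for w
    by (simp add: add_pos_nonneg)
  have F'_pos: "0 < ?F' w" for w
    using m0 root by simp
  note inv = positive_derivative_inverse[of F ?F', OF F F'_pos]
  show inj: "inj F" using inv(1) by (rule strict_mono_imp_inj_on)
  have sol: "0 < radius m c (inv F s) \<and>
        ((\<lambda>s. radius m c (inv F s)) has_real_derivative sin (arctan (slope m c (inv F s)) + \<theta>)) (at s) \<and>
        ((\<lambda>s. height m c (inv F s) + d) has_real_derivative cos (arctan (slope m c (inv F s)) + \<theta>)) (at s) \<and>
        ((\<lambda>s. arctan (slope m c (inv F s)) + \<theta>) has_real_derivative
           (2 * real n - 1) * (cos (arctan (slope m c (inv F s)) + \<theta>)) ^ 3 / (radius m c (inv F s)) ^ 3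
           + 2 * (real n - 1) * ((sin (arctan (slope m c (inv F s)) + \<theta>))\<^sup>2
              * cos (arctan (slope m c (inv F s)) + \<theta>)) / radius m c (inv F s)) (at s)"
    if "s \<in> range F" for s
  proof -
    obtain w where s: "s = F w" using \<open>s \<in> range F\<close> by (rule rangeE)
    define X q r where "X = radius m c w" "q = slope m c w" "r = sqrt (1 + q\<^sup>2)"
    have W: "inv F s = w" using inj by (simp add: s)
    have r: "0 < r" "r\<^sup>2 = 1 + q\<^sup>2" and X: "0 < X"
      using root[of w] by (simp_all add: X_q_r_def add_nonneg_nonneg)
    have sinh: "sinh w = q * X" by (simp add: X_q_r_def slope_def)
    have dW: "(inv F has_real_derivative m * cosh w / (r * X\<^sup>2)) (at s)"
      using inv(4)[of w] by (simp add: s X_q_r_def field_simps)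
    have sin: "sin (arctan q + \<theta>) = q / r" and cos: "cos (arctan q + \<theta>) = 1 / r"
      using \<theta> by (simp_all add: sin_add cos_add sin_arctan cos_arctan X_q_r_def)
    have "((\<lambda>s. radius m c (inv F s)) has_real_derivative q / r) (at s)"
      using m0 X by (intro DERIV_cong[OF DERIV_chain2[OF DERIV_radius dW]])
        (simp add: W X_q_r_def(1)[symmetric] sinh field_simps power2_eq_square)
    moreover have "((\<lambda>s. height m c (inv F s) + d) has_real_derivative 1 / r) (at s)"
      using m0 X
      by (intro DERIV_cong[OF DERIV_add[OF DERIV_chain2[OF DERIV_height dW] DERIV_const]])
        (simp_all add: W X_q_r_def(1)[symmetric])
    moreover have "((\<lambda>s. arctan (slope m c (inv F s)) + \<theta>) has_real_derivative
        m * (1 / r) ^ 3 / X ^ 3 + (m - 1) * ((q / r)\<^sup>2 * (1 / r)) / X) (at s)"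
    proof (rule DERIV_cong[OF DERIV_add[OF
            DERIV_chain2[OF DERIV_arctan DERIV_chain2[OF DERIV_slope dW]] DERIV_const]])
      have "inverse (r\<^sup>2) * ((m + (m - 1) * (q * X)\<^sup>2) / (m * cosh w * X) * (m * cosh w / (r * X\<^sup>2)))
          = m * (1 / r) ^ 3 / X ^ 3 + (m - 1) * ((q / r)\<^sup>2 * (1 / r)) / X"
        using m0 X r(1) by (simp add: field_simps power2_eq_square power3_eq_cube)
      then show "inverse (1 + (slope m c (inv F s))\<^sup>2) * ((m + (m - 1) * (sinh (inv F s))\<^sup>2) /
            (m * cosh (inv F s) * radius m c (inv F s)) * (m * cosh w / (r * X\<^sup>2))) + 0
          = m * (1 / r) ^ 3 / X ^ 3 + (m - 1) * ((q / r)\<^sup>2 * (1 / r)) / X"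
        by (simp add: W sinh r(2) X_q_r_def(1,2)[symmetric])
    qed (use m0 in simp)
    moreover have "2 * (real n - 1) = m - 1" by (simp add: m)
    ultimately show ?thesis
      using X by (simp only: W X_q_r_def(1,2)[symmetric] sin cos m[symmetric])
  qed
  then show "profile_solution n (range F) (\<lambda>s. radius m c (inv F s)) (\<lambda>s. height m c (inv F s) + d)
      (\<lambda>s. arctan (slope m c (inv F s)) + \<theta>)"
    unfolding profile_solution_def using inv(2,3) by (intro conjI ballI) simp_all
qed

text \<open>
  The model extends the given solution, so by maximality the two have the same domain, and the
  curve is the whole model.
\<close>

lemma maximal_transverse_profile:
  assumes max: "maximal_profile_solution n J x t \<sigma>" and n: "1 \<le> n" and m: "m = 2 * real n - 1"
    and pos: "\<And>s. s \<in> J \<Longrightarrow> 0 < cos (\<sigma> s)"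
  obtains c d where "(\<lambda>s. (x s, t s)) ` J = range (\<lambda>w. (radius m c w, height m c w + d))"
proof -
  have sol: "profile_solution n J x t \<sigma>"
    using max by (simp add: maximal_profile_solution_def)
  obtain c \<delta> d \<theta> w where \<theta>: "sin \<theta> = 0" "cos \<theta> = 1"
    and model_eq: "\<forall>s\<in>J. s = arclength m c (w s) + \<delta> \<and> x s = radius m c (w s) \<and>
      t s = height m c (w s) + d \<and> \<sigma> s = arctan (slope m c (w s)) + \<theta>"
    using transverse_profile_is_model[OF sol n m pos] by blast
  define F where "F = (\<lambda>w. arclength m c w + \<delta>)"
  note inj = profile_solution_model(1)[OF n m \<theta>, where c = c and \<delta> = \<delta>, folded F_def]
  note model = profile_solution_model(2)[OF n m \<theta>, where c = c and \<delta> = \<delta> and d = d, folded F_def]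
  have J: "J \<subseteq> range F"
    using model_eq by (auto simp: F_def)
  have W: "inv F s = w s" if "s \<in> J" for s
    using model_eq that by (intro inv_f_eq[OF inj]) (simp add: F_def)
  have agree: "\<forall>s\<in>J. radius m c (inv F s) = x s \<and> height m c (inv F s) + d = t s \<and>
      arctan (slope m c (inv F s)) + \<theta> = \<sigma> s"
    using model_eq by (simp add: W)
  then have "range F = J"
    using max model J unfolding maximal_profile_solution_def by blast
  then have "(\<lambda>s. (x s, t s)) ` J = (\<lambda>s. (radius m c (inv F s), height m c (inv F s) + d)) ` range F"
    using agree by (intro image_cong) auto
  also have "\<dots> = range (\<lambda>w. (radius m c w, height m c w + d))"
    using inj by (simp add: image_image)
  finally show thesis by (rule that)
qed

text \<open>
  Reflection in the hyperplane \<open>t = 0\<close> reverses the sign of \<open>cos \<sigma>\<close>.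
\<close>

lemma profile_solution_reflect:
  assumes "profile_solution n J x t \<sigma>"
  shows "profile_solution n J x (\<lambda>s. - t s) (\<lambda>s. pi - \<sigma> s)"
  using assms unfolding profile_solution_def
  by (auto intro!: derivative_eq_intros simp: algebra_simps diff_divide_distrib add_divide_distrib)

lemma maximal_profile_solution_reflect:
  assumes "maximal_profile_solution n J x t \<sigma>"
  shows "maximal_profile_solution n J x (\<lambda>s. - t s) (\<lambda>s. pi - \<sigma> s)"
  unfolding maximal_profile_solution_def
proof (intro conjI allI impI)
  show "profile_solution n J x (\<lambda>s. - t s) (\<lambda>s. pi - \<sigma> s)"
    using assms by (simp add: maximal_profile_solution_def profile_solution_reflect)
  fix J' x' t' \<sigma>'
  assume "profile_solution n J' x' t' \<sigma>'" "J \<subseteq> J'"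
    "\<forall>s\<in>J. x' s = x s \<and> t' s = - t s \<and> \<sigma>' s = pi - \<sigma> s"
  then have "profile_solution n J' x' (\<lambda>s. - t' s) (\<lambda>s. pi - \<sigma>' s)" "J \<subseteq> J'"
    "\<forall>s\<in>J. x' s = x s \<and> - t' s = t s \<and> pi - \<sigma>' s = \<sigma> s"
    by (simp_all add: profile_solution_reflect)
  then show "J' = J"
    using assms unfolding maximal_profile_solution_def by blast
qed

text \<open>
  Here \<open>\<sigma>' = 0\<close> as well, and the solution \<open>x = \<epsilon> s + b\<close> with \<open>\<epsilon> = \<plusminus>1\<close> extends to all \<open>s\<close> for which
  the right-hand side is positive.
\<close>

lemma maximal_profile_orthogonal_to_axis:
  assumes max: "maximal_profile_solution n J x t \<sigma>" and zero: "\<And>s. s \<in> J \<Longrightarrow> cos (\<sigma> s) = 0"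
  obtains d where "(\<lambda>s. (x s, t s)) ` J = {0<..} \<times> {d}"
proof -
  have sol: "profile_solution n J x t \<sigma>"
    using max by (simp add: maximal_profile_solution_def)
  have J: "convex J" "J \<noteq> {}"
    using sol by (auto simp: profile_solution_def is_interval_convex)
  have const: "\<exists>k. \<forall>s\<in>J. g s = k"
    if "\<And>s. s \<in> J \<Longrightarrow> (g has_real_derivative 0) (at s)" for g
    using J that by (intro has_field_derivative_zero_constant) (auto intro: has_field_derivative_at_within)
  have x: "0 < x s" "(x has_real_derivative sin (\<sigma> s)) (at s)"
    and dt: "(t has_real_derivative 0) (at s)" and d\<sigma>: "(\<sigma> has_real_derivative 0) (at s)"
    if "s \<in> J" for s
    using sol that zero[OF that] by (auto simp: profile_solution_def)
  obtain d where d: "\<forall>s\<in>J. t s = d" using const dt by blast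
  obtain \<theta> where \<theta>: "\<forall>s\<in>J. \<sigma> s = \<theta>" using const d\<sigma> by blast
  define \<epsilon> where "\<epsilon> = sin \<theta>"
  have cos: "cos \<theta> = 0" using zero \<theta> J(2) by auto
  then have \<epsilon>: "\<epsilon> * \<epsilon> = 1"
    using sin_cos_squared_add[of \<theta>] by (simp add: \<epsilon>_def power2_eq_square)
  have "((\<lambda>s. x s - \<epsilon> * s) has_real_derivative 0) (at s)" if s: "s \<in> J" for s
    using x(2)[OF s] s \<theta> by (auto intro!: derivative_eq_intros simp: \<epsilon>_def)
  then obtain b where b: "\<forall>s\<in>J. x s - \<epsilon> * s = b" using const by blast
  then have xb: "x s = \<epsilon> * s + b" if "s \<in> J" for s using that by force
  define J' where "J' = {s. 0 < \<epsilon> * s + b}"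
  have "profile_solution n J' (\<lambda>s. \<epsilon> * s + b) (\<lambda>s. d) (\<lambda>s. \<theta>)"
    unfolding profile_solution_def
  proof (intro conjI ballI)
    show "open J'"
      unfolding J'_def by (intro open_Collect_less continuous_intros)
    show "J' \<noteq> {}" "is_interval J'"
    proof -
      have "J \<subseteq> J'" using xb x(1) by (auto simp: J'_def)
      then show "J' \<noteq> {}" using J(2) by auto
      have "convex ((\<lambda>s. \<epsilon> * s) -` {- b<..})"
        by (intro convex_linear_vimage) (auto simp: linear_times)
      also have "(\<lambda>s. \<epsilon> * s) -` {- b<..} = J'" by (auto simp: J'_def)
      finally show "is_interval J'" by (simp add: is_interval_convex_1)
    qed
  qed (use cos in \<open>auto simp: J'_def \<epsilon>_def intro!: derivative_eq_intros\<close>)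
  moreover have "J \<subseteq> J'" using xb x(1) by (auto simp: J'_def)
  moreover have "\<forall>s\<in>J. \<epsilon> * s + b = x s \<and> d = t s \<and> \<theta> = \<sigma> s"
    using d \<theta> xb by simp
  ultimately have "J' = J"
    using max unfolding maximal_profile_solution_def by blast
  have "(\<lambda>s. (x s, t s)) ` J = {0<..} \<times> {d}"
  proof (intro equalityI subsetI)
    fix p :: "real \<times> real" assume "p \<in> {0<..} \<times> {d}"
    then obtain r where r: "0 < r" "p = (r, d)" by auto
    define s where "s = \<epsilon> * (r - b)"
    have "\<epsilon> * s + b = r"
      by (simp add: s_def mult.assoc[symmetric] \<epsilon>)
    then have "s \<in> J" "x s = r" using r \<open>J' = J\<close> xb by (auto simp: J'_def)
    then show "p \<in> (\<lambda>s. (x s, t s)) ` J" using r d by force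
  qed (use d x(1) in auto)
  then show thesis by (rule that)
qed

section \<open>Classification of the complete hypersurfaces\<close>

lemma revolve_half_line:
  "revolve ({0..} \<times> {d}) = {p :: 'n::finite heis. (0, 1) \<bullet> p = d}"
proof (intro equalityI subsetI)
  fix p :: "'n heis" assume p: "p \<in> {p. (0, 1) \<bullet> p = d}"
  obtain z h where zh: "p = (z, h)" by (cases p)
  obtain e :: "complex ^ 'n" where e: "norm e = 1"
    using vector_choose_size[of 1] by auto
  define \<omega> where "\<omega> = (if z = 0 then e else z /\<^sub>R norm z)"
  have "norm \<omega> = 1" "z = norm z *\<^sub>R \<omega>" using e by (auto simp: \<omega>_def)
  moreover have "h = d" using p by (simp add: zh inner_prod_def)
  ultimately show "p \<in> revolve ({0..} \<times> {d})"
    unfolding revolve_def zh by force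
qed (auto simp: revolve_def inner_prod_def)

text \<open>
  The value of the first integral decides between the two kinds of curves. Where it is nonzero, the
  sign of \<open>cos \<sigma>\<close> is constant by connectedness; the negative sign is reduced to the positive one by
  reflection, which maps a model curve to a model curve because the height is odd.
\<close>

lemma maximal_profile_cases:
  assumes max: "maximal_profile_solution n J x t \<sigma>" and n: "1 \<le> n" and m: "m = 2 * real n - 1"
  obtains (half_line) d where "(\<lambda>s. (x s, t s)) ` J = {0<..} \<times> {d}"
    | (catenary) c d where
      "(\<lambda>s. (x s, t s)) ` J = range (\<lambda>w. (radius m c w, height m c w + d))"
proof -
  have sol: "profile_solution n J x t \<sigma>"
    using max by (simp add: maximal_profile_solution_def)
  obtain Q where Q: "\<And>s. s \<in> J \<Longrightarrow>
    exp (2 * m * ln (x s)) * (cos (\<sigma> s))\<^sup>2 / ((cos (\<sigma> s))\<^sup>2 + (x s)\<^sup>2 * (sin (\<sigma> s))\<^sup>2) = Q"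
    using profile_first_integral[OF sol m] by blast
  have zero_iff: "cos (\<sigma> s) = 0 \<longleftrightarrow> Q = 0" if s: "s \<in> J" for s
  proof -
    have "0 < x s" using sol s by (simp add: profile_solution_def)
    then have "(cos (\<sigma> s))\<^sup>2 + (x s)\<^sup>2 * (sin (\<sigma> s))\<^sup>2 \<noteq> 0"
      using sin_zero_abs_cos_one[of "\<sigma> s"]
      by (auto simp: power_mult_distrib[symmetric] sum_power2_eq_zero_iff)
    then show ?thesis using Q[OF s] by auto
  qed
  have "continuous_on J \<sigma>"
    using sol by (auto simp: profile_solution_def intro!: DERIV_isCont continuous_at_imp_continuous_on)
  then have "connected ((\<lambda>s. cos (\<sigma> s)) ` J)"
    using sol by (intro connected_continuous_image continuous_intros)
      (auto simp: profile_solution_def is_interval_connected_1)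
  then have sign: "0 \<in> (\<lambda>s. cos (\<sigma> s)) ` J"
    if "u \<in> J" "v \<in> J" "cos (\<sigma> u) \<le> 0" "0 \<le> cos (\<sigma> v)" for u v
    using that connectedD_interval[of "(\<lambda>s. cos (\<sigma> s)) ` J" "cos (\<sigma> u)" "cos (\<sigma> v)" 0] by blast
  consider "\<And>s. s \<in> J \<Longrightarrow> cos (\<sigma> s) = 0" | "\<And>s. s \<in> J \<Longrightarrow> 0 < cos (\<sigma> s)"
    | "\<And>s. s \<in> J \<Longrightarrow> cos (\<sigma> s) < 0"
    using zero_iff sign by (smt (verit) imageE)
  then show thesis
  proof cases
    case 1
    then show ?thesis using maximal_profile_orthogonal_to_axis[OF max] half_line by blast
  next
    case 2
    then show ?thesis using maximal_transverse_profile[OF max n m] catenary by blast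
  next
    case 3
    then have "0 < cos (pi - \<sigma> s)" if "s \<in> J" for s
      using that by (simp add: cos_diff)
    then obtain c d where cd:
      "(\<lambda>s. (x s, - t s)) ` J = range (\<lambda>w. (radius m c w, height m c w + d))"
      using maximal_transverse_profile[OF maximal_profile_solution_reflect[OF max] n m] by blast
    have m0: "m \<noteq> 0" using n m by auto
    have "(\<lambda>s. (x s, t s)) ` J = (\<lambda>(r, h). (r, - h)) ` (\<lambda>s. (x s, - t s)) ` J"
      by (simp add: image_image)
    also have "\<dots> = range (\<lambda>w. (radius m c (- w), height m c (- w) + - d))"
      by (simp add: cd image_image height_minus[OF m0])
    also have "\<dots> = (\<lambda>w. (radius m c w, height m c w + - d)) ` range uminus"
      by (simp only: image_image)
    also have "range uminus = (UNIV :: real set)"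
      by simp
    finally show ?thesis by (rule catenary)
  qed
qed

theorem corollary5p5:
  fixes \<Sigma> :: "((complex ^ 'n::finite) \<times> real) set"
  assumes "complete_minimal_revolution \<Sigma>"
  shows "hyperplane_orthogonal_to_t_axis \<Sigma> \<or> catenoidal_type \<Sigma>"
proof -
  obtain I x t \<sigma> where gen: "generating_curve I x t \<sigma>"
    and \<Sigma>: "\<Sigma> = revolve ((\<lambda>s. (x s, t s)) ` I)"
    and complete: "complete_generating_curve CARD('n) I x t \<sigma>"
    using assms unfolding complete_minimal_revolution_def by blast
  define m where "m = 2 * real CARD('n) - 1"
  define \<Gamma> where "\<Gamma> = (\<lambda>s. (x s, t s)) ` off_axis x I"
  have max: "maximal_profile_solution CARD('n) (off_axis x I) x t \<sigma>"
    and axis: "(\<lambda>s. (x s, t s)) ` {s \<in> I. x s = 0} = {p \<in> closure \<Gamma>. fst p = 0}"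
    using complete by (simp_all add: complete_generating_curve_def \<Gamma>_def)
  have "\<forall>s\<in>I. 0 \<le> x s" using gen by (simp add: generating_curve_def)
  then have split: "off_axis x I \<union> {s \<in> I. x s = 0} = I"
    by (auto simp: off_axis_def less_le)
  have "(\<lambda>s. (x s, t s)) ` (off_axis x I \<union> {s \<in> I. x s = 0}) = \<Gamma> \<union> {p \<in> closure \<Gamma>. fst p = 0}"
    by (simp only: image_Un axis \<Gamma>_def[symmetric])
  then have curve: "(\<lambda>s. (x s, t s)) ` I = \<Gamma> \<union> {p \<in> closure \<Gamma>. fst p = 0}"
    by (simp only: split)
  have card: "1 \<le> CARD('n)" by (simp add: Suc_le_eq)
  show ?thesis
    using max card m_def
  proof (cases rule: maximal_profile_cases)
    case (half_line d)
    have "closure \<Gamma> = {0..} \<times> {d}"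
      unfolding \<Gamma>_def half_line by (simp add: closure_Times)
    then have "(\<lambda>s. (x s, t s)) ` I = {0..} \<times> {d}"
      unfolding curve by (auto simp: \<Gamma>_def half_line)
    then show ?thesis
      by (auto simp: \<Sigma> revolve_half_line hyperplane_orthogonal_to_t_axis_def)
  next
    case (catenary c d)
    have m: "1 \<le> m" using card by (simp add: m_def)
    have "\<Gamma> \<subseteq> {radius m c 0..} \<times> UNIV"
      using m by (auto simp: \<Gamma>_def catenary radius_def cosh_real_ge_1 divide_right_mono)
    then have "closure \<Gamma> \<subseteq> {radius m c 0..} \<times> UNIV"
      by (intro closure_minimal closed_Times) auto
    then have no_axis: "{p \<in> closure \<Gamma>. fst p = 0} = {}"
      using radius_pos[of m c 0] by (force simp del: radius_pos)
    then have "(\<lambda>s. (x s, t s)) ` I = range (\<lambda>w. (radius m c w, height m c w + d))"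
      unfolding curve no_axis by (simp add: \<Gamma>_def catenary)
    then have "catenoidal_type \<Sigma>"
      unfolding \<Sigma> by (simp only: catenoidal_type_model[OF m])
    then show ?thesis ..
  qed
qed

end
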